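(* Consider the forward complete system $\dot x=f(x,d)$ with output $y=h(x)$ described in the context. Suppose that there exist a constant $r>0$, continuously differentiable functions $V,W,Q:\mathbb{R}^n\to\mathbb{R}_{\ge0}$, a function $a\in\mathcal{K}$ and a continuous positive definite function $\rho:\mathbb{R}_{\ge0}\to\mathbb{R}_{\ge0}$ such that, for all $x\in\mathbb{R}^n$ and all $d\in D$, $$\nabla V(x)f(x,d)\le-\rho(W(x)),\qquad \nabla Q(x)f(x,d)\le 0,$$ and, for all $x\in\mathbb{R}^n$ with $W(x)<r$, $$a(|h(x)|)\le W(x).$$ Moreover, suppose that there exists a continuous function $\gamma:\mathbb{R}_{\ge0}\to\mathbb{R}_{\ge0}$ such that at least one of the following holds: (i) for all $d\in D$ and all $x\in\mathbb{R}^n$ with $W(x)<r$: $\nabla W(x)f(x,d)\le\gamma(Q(x))$; (ii) for all $x\in\mathbb{R}^n$ and all $d\in D$: $\nabla W(x)f(x,d)\ge-\gamma(Q(x))$. Finally, suppose that either $\liminf_{s\to+\infty}\rho(s)>0$, or there exists $\zeta\in\mathcal{K}_\infty$ such that $W(x)\le\zeta(Q(x))$ for all $x\in\mathbb{R}^n$. Then the system is RGOA, i.e. for every $x_0\in\mathbb{R}^n$ and every $d\in L^\infty_{loc}(\mathbb{R}_{\ge0};D)$, $\lim_{t\to+\infty}y(t,x_0;d)=0$.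
   Context: Setting. $D\subseteq\mathbb{R}^m$ is a non-empty set, and $f:\mathbb{R}^n\times D\to\mathbb{R}^n$ is continuous and locally Lipschitz in its first variable, uniformly in the second on bounded subsets of $D$: for every compact $S\subseteq\mathbb{R}^n$ and every bounded $K\subseteq D$ there is $L_{S,K}>0$ such that $|f(x,d)-f(z,d)|\le L_{S,K}|x-z|$ for all $x,z\in S$, $d\in K$. Moreover $f(0,d)=0$ for all $d\in D$. The output map $h:\mathbb{R}^n\to\mathbb{R}^k$ is continuous with $h(0)=0$. Consider $\dot x=f(x,d)$, $y=h(x)$, with inputs $d\in L^\infty_{loc}(\mathbb{R}_{\ge 0};D)$ (measurable, locally essentially bounded functions $\mathbb{R}_{\ge0}\to D$). The system is assumed forward complete: for every $x_0\in\mathbb{R}^n$ and every such $d$ the unique solution $\phi(t,x_0;d)$ with $\phi(0,x_0;d)=x_0$ exists for all $t\ge 0$. Write $y(t,x_0;d):=h(\phi(t,x_0;d))$. Notation. $|\cdot|$ is the Euclidean norm. $\mathcal{K}$ is the set of continuous (strictly) increasing $\alpha:\mathbb{R}_{\ge0}\to\mathbb{R}_{\ge0}$ with $\alpha(0)=0$; $\mathcal{K}_\infty$ is the set of $\alpha\in\mathcal{K}$ with $\lim_{s\to+\infty}\alpha(s)=+\infty$. A function $\rho:\mathbb{R}_{\ge0}\to\mathbb{R}_{\ge0}$ is positive definite if $\rho(0)=0$ and $\rho(s)>0$ for $s>0$. RGOA stands for "robustly globally output attractive". *)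

theory Defs
  imports "HOL-Analysis.Analysis"
begin

section \<open>Comparison functions\<close>

text \<open>
  A function from the nonnegative reals to themselves is represented by a function
  \<open>real \<Rightarrow> real\<close> of which only the values on \<open>{0..}\<close> matter.
\<close>

definition class_K :: "(real \<Rightarrow> real) \<Rightarrow> bool" where
  "class_K \<alpha> \<longleftrightarrow> continuous_on {0..} \<alpha> \<and> strict_mono_on {0..} \<alpha> \<and> \<alpha> 0 = 0"

definition class_Kinf :: "(real \<Rightarrow> real) \<Rightarrow> bool" where
  "class_Kinf \<alpha> \<longleftrightarrow> class_K \<alpha> \<and> filterlim \<alpha> at_top at_top"

definition positive_definite :: "(real \<Rightarrow> real) \<Rightarrow> bool" where
  "positive_definite \<rho> \<longleftrightarrow> \<rho> 0 = 0 \<and> (\<forall>s>0. \<rho> s > 0)"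

lemma class_K_nonneg: "class_K \<alpha> \<Longrightarrow> 0 \<le> s \<Longrightarrow> 0 \<le> \<alpha> s"
  unfolding class_K_def
  by (metis atLeast_iff order_refl strict_mono_on_leD)

section \<open>Continuously differentiable scalar functions\<close>

definition gradient :: "('a::real_inner \<Rightarrow> real) \<Rightarrow> 'a \<Rightarrow> 'a" where
  "gradient V x = (THE g. GDERIV V x :> g)"

definition continuously_differentiable :: "('a::real_inner \<Rightarrow> real) \<Rightarrow> bool" where
  "continuously_differentiable V \<longleftrightarrow>
     (\<exists>G. (\<forall>x. GDERIV V x :> G x) \<and> continuous_on UNIV G)"

lemma gradient_eq:
  assumes "GDERIV V x :> g"
  shows "gradient V x = g"
proof -
  have "g' = g" if "GDERIV V x :> g'" for g'
  proof -
    have "(\<lambda>u. u \<bullet> g') = (\<lambda>u. u \<bullet> g)"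
      using assms that has_derivative_unique unfolding gderiv_def by blast
    then have "\<And>u. u \<bullet> g' = u \<bullet> g"
      by metis
    then show ?thesis
      using vector_eq_ldot by blast
  qed
  then show ?thesis
    unfolding gradient_def using assms by blast
qed

section \<open>Systems with inputs\<close>

definition standing_assumptions ::
    "(real^'m) set \<Rightarrow> (real^'n \<Rightarrow> real^'m \<Rightarrow> real^'n) \<Rightarrow> (real^'n \<Rightarrow> real^'k) \<Rightarrow> bool" where
  "standing_assumptions D f h \<longleftrightarrow>
     D \<noteq> {} \<and>
     continuous_on (UNIV \<times> D) (\<lambda>(x, d). f x d) \<and>
     (\<forall>S K. compact S \<and> bounded K \<and> K \<subseteq> D \<longrightarrow>
        (\<exists>L>0. \<forall>x\<in>S. \<forall>z\<in>S. \<forall>d\<in>K. norm (f x d - f z d) \<le> L * norm (x - z))) \<and>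
     (\<forall>d\<in>D. f 0 d = 0) \<and>
     continuous_on UNIV h \<and> h 0 = 0"

text \<open>
  Inputs and trajectories are functions of time on \<open>{0..}\<close>; values at negative
  times are irrelevant.
\<close>

definition inputs :: "(real^'m) set \<Rightarrow> (real \<Rightarrow> real^'m) set" where
  "inputs D = {d. d \<in> borel_measurable (lebesgue_on {0..}) \<and>
                  (\<forall>t\<ge>0. d t \<in> D) \<and>
                  (\<forall>T\<ge>0. \<exists>M. AE t in lebesgue_on {0..T}. norm (d t) \<le> M)}"

text \<open>
  Absolute continuity of a function of a real variable. The finite set \<open>P\<close> consists of
  the pairs of end points of non-overlapping closed subintervals.
\<close>

definition abs_continuous_on :: "real set \<Rightarrow> (real \<Rightarrow> 'a::real_normed_vector) \<Rightarrow> bool" where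
  "abs_continuous_on S \<phi> \<longleftrightarrow>
     (\<forall>\<epsilon>>0. \<exists>\<delta>>0. \<forall>P. finite P \<and>
        (\<forall>(a, b)\<in>P. a \<le> b \<and> {a..b} \<subseteq> S) \<and>
        disjoint_family_on (\<lambda>(a, b). {a<..<b}) P \<and>
        (\<Sum>(a, b)\<in>P. b - a) < \<delta> \<longrightarrow>
        (\<Sum>(a, b)\<in>P. norm (\<phi> b - \<phi> a)) < \<epsilon>)"

text \<open>
  As the inputs are merely measurable, solutions are understood in the sense of Caratheodory.
  They are solutions on the whole half-line.
\<close>

definition solution ::
    "(real^'n \<Rightarrow> real^'m \<Rightarrow> real^'n) \<Rightarrow> real^'n \<Rightarrow> (real \<Rightarrow> real^'m) \<Rightarrow> (real \<Rightarrow> real^'n) \<Rightarrow> bool" where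
  "solution f x0 d \<phi> \<longleftrightarrow>
     \<phi> 0 = x0 \<and>
     (\<forall>T>0. abs_continuous_on {0..T} \<phi>) \<and>
     (AE t in lebesgue_on {0..}.
        (\<phi> has_vector_derivative f (\<phi> t) (d t)) (at t within {0..}))"

text \<open>
  Uniqueness of solutions follows from the Lipschitz condition in
  \<^const>\<open>standing_assumptions\<close>. Hence only existence is demanded in \<open>forward_complete\<close>,
  and in \<open>RGOA\<close> quantifying over all solutions amounts to speaking about the
  solution.
\<close>

definition forward_complete ::
    "(real^'m) set \<Rightarrow> (real^'n \<Rightarrow> real^'m \<Rightarrow> real^'n) \<Rightarrow> bool" where
  "forward_complete D f \<longleftrightarrow> (\<forall>x0. \<forall>d\<in>inputs D. \<exists>\<phi>. solution f x0 d \<phi>)"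

definition RGOA ::
    "(real^'m) set \<Rightarrow> (real^'n \<Rightarrow> real^'m \<Rightarrow> real^'n) \<Rightarrow> (real^'n \<Rightarrow> real^'k) \<Rightarrow> bool" where
  "RGOA D f h \<longleftrightarrow>
     (\<forall>x0. \<forall>d\<in>inputs D. \<forall>\<phi>. solution f x0 d \<phi> \<longrightarrow> ((\<lambda>t. h (\<phi> t)) \<longlongrightarrow> 0) at_top)"

end

theory Submission
  imports Defs
begin

text \<open>
  Along a solution \<open>V\<close> and \<open>Q\<close> are nonincreasing, so \<open>\<gamma> (Q x)\<close> stays below a constant \<open>M\<close>.
  If \<open>W\<close> reaches \<open>\<epsilon>\<close> at time \<open>t\<close>, then \<open>W \<ge> \<epsilon> / 2\<close> on a time interval of
  length \<open>\<tau> = \<epsilon> / (2 * M)\<close> ending at \<open>t\<close> in case (i) and starting at \<open>t\<close> in case (ii).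
  There \<open>\<rho> (W x)\<close> is bounded below by some \<open>c > 0\<close>, so \<open>V\<close> drops by \<open>c * \<tau>\<close>. As
  \<open>V \<ge> 0\<close> converges, this cannot happen at arbitrarily late times; hence \<open>W\<close>, and with it
  the output, tends to \<open>0\<close>.
\<close>

section \<open>Absolutely continuous functions\<close>

lemma abs_continuous_onE:
  assumes "abs_continuous_on S \<phi>" "\<epsilon> > 0"
  obtains \<delta> where "\<delta> > 0"
    and "\<And>P. finite P \<Longrightarrow> (\<forall>(u, v)\<in>P. u \<le> v \<and> {u..v} \<subseteq> S) \<Longrightarrow>
      disjoint_family_on (\<lambda>(u, v). {u<..<v}) P \<Longrightarrow> (\<Sum>(u, v)\<in>P. v - u) < \<delta> \<Longrightarrow>
      (\<Sum>(u, v)\<in>P. norm (\<phi> v - \<phi> u)) < \<epsilon>"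
proof -
  obtain \<delta> where \<delta>: "\<delta> > 0" "\<forall>P. finite P \<and> (\<forall>(u, v)\<in>P. u \<le> v \<and> {u..v} \<subseteq> S) \<and>
      disjoint_family_on (\<lambda>(u, v). {u<..<v}) P \<and> (\<Sum>(u, v)\<in>P. v - u) < \<delta> \<longrightarrow>
      (\<Sum>(u, v)\<in>P. norm (\<phi> v - \<phi> u)) < \<epsilon>"
    using assms(1)[unfolded abs_continuous_on_def, rule_format, OF assms(2)] by (elim exE conjE) rule
  show thesis
    by (rule that[OF \<delta>(1)], rule \<delta>(2)[rule_format], intro conjI)
qed

text \<open>
  Cousin's lemma replaces the fundamental theorem of calculus: in a tagged division of
  \<open>{a..b}\<close> that is fine enough, the intervals tagged outside the exceptional set \<open>N\<close>
  obey the bound on the difference quotient, while those tagged in \<open>N\<close> have small total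
  length, and absolute continuity makes their contribution small.
\<close>

lemma abs_continuous_on_deriv_le:
  fixes g :: "real \<Rightarrow> real"
  assumes ac: "abs_continuous_on {a..b} g" and "a \<le> b" and N: "negligible N"
    and deriv: "\<And>t. t \<in> {a..b} - N \<Longrightarrow>
      \<exists>g'\<le>c. (g has_vector_derivative g') (at t within {a..b})"
  shows "g b - g a \<le> c * (b - a)"
proof -
  \<comment> \<open>The slack has three sources: \<open>e\<close> is added to the slope
    \<open>c\<close> to absorb the differentiation error, and over the intervals tagged in
    \<open>N\<close> one \<open>e\<close> pays for the variation of \<open>g\<close> and another for
    the linear term.\<close>
  have key: "g b - g a \<le> (c + e) * (b - a) + 2 * e" if "e > 0" for e
  proof -
    define C where "C = c + e"
    obtain \<delta> where "\<delta> > 0" and \<delta>: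
      "\<And>P. finite P \<Longrightarrow> (\<forall>(u, v)\<in>P. u \<le> v \<and> {u..v} \<subseteq> {a..b}) \<Longrightarrow>
        disjoint_family_on (\<lambda>(u, v). {u<..<v}) P \<Longrightarrow> (\<Sum>(u, v)\<in>P. v - u) < \<delta> \<Longrightarrow>
        (\<Sum>(u, v)\<in>P. norm (g v - g u)) < e"
      by (rule abs_continuous_onE[OF ac \<open>e > 0\<close>]) (rule that)
    \<comment> \<open>A total length below \<open>\<eta>\<close> meets the demand of absolute
      continuity and also keeps the linear term below \<open>e\<close>; the \<open>+ 1\<close>
      guards against \<open>C = 0\<close>.\<close>
    define \<eta> where "\<eta> = min \<delta> (e / (\<bar>C\<bar> + 1))"
    have \<eta>: "\<eta> > 0" "\<eta> \<le> \<delta>" "\<bar>C\<bar> * \<eta> \<le> e"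
    proof -
      show "\<eta> > 0" "\<eta> \<le> \<delta>"
        using \<open>\<delta> > 0\<close> \<open>e > 0\<close> by (auto simp: \<eta>_def)
      have "\<bar>C\<bar> * \<eta> \<le> \<bar>C\<bar> * (e / (\<bar>C\<bar> + 1))"
        by (intro mult_left_mono) (auto simp: \<eta>_def)
      also have "\<dots> \<le> e"
        using \<open>e > 0\<close> by (auto simp: field_simps)
      finally show "\<bar>C\<bar> * \<eta> \<le> e" .
    qed
    have "N \<in> sets lebesgue"
      using N by (auto simp: negligible_iff_null_sets)
    then obtain U where U: "open U" "N \<subseteq> U" "U - N \<in> lmeasurable"
        "emeasure lebesgue (U - N) < ennreal \<eta>"
      using sets_lebesgue_outer_open[OF _ \<eta>(1)] by metis
    have Um: "U \<in> lmeasurable" and "measure lebesgue U < \<eta>"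
    proof -
      have eq: "U = (U - N) \<union> N" using U by auto
      have "(U - N) \<union> N \<in> lmeasurable"
        using U(3) negligible_imp_measurable[OF N] by (rule fmeasurable.Un)
      then show "U \<in> lmeasurable"
        using eq by simp
      have "measure lebesgue U = measure lebesgue (U - N)"
        by (metis N U(3) eq measure_Un_null_set negligible_iff_null_sets fmeasurableD)
      also have "\<dots> < \<eta>"
        using U(3,4) \<eta>(1) by (simp add: emeasure_eq_measure2 ennreal_less_iff)
      finally show "measure lebesgue U < \<eta>" .
    qed
    \<comment> \<open>Choice of the gauge: at a tag in \<open>N\<close> the ball stays inside the
      small open set \<open>U\<close>; at a tag in \<open>{a..b} - N\<close> it is so small that
      every interval around the tag obeys the slope bound \<open>C\<close>.\<close>
    have "\<exists>d>0. (x \<in> N \<longrightarrow> ball x d \<subseteq> U) \<and>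
        (x \<in> {a..b} - N \<longrightarrow> (\<forall>u v. a \<le> u \<and> u \<le> x \<and> x \<le> v \<and> v \<le> b \<and> {u..v} \<subseteq> ball x d \<longrightarrow>
           g v - g u \<le> C * (v - u)))" for x
    proof (cases "x \<in> N")
      case True
      then show ?thesis
        using U(1,2) openE by blast
    next
      case False
      show ?thesis
      proof (cases "x \<in> {a..b}")
        case True
        then obtain g' where "g' \<le> c" "(g has_vector_derivative g') (at x within {a..b})"
          using deriv False by blast
        then obtain d where "d > 0" and d: "\<And>y. y \<in> {a..b} \<Longrightarrow> \<bar>y - x\<bar> < d \<Longrightarrow>
            \<bar>g y - g x - (y - x) * g'\<bar> \<le> e * \<bar>y - x\<bar>"
          using \<open>e > 0\<close> unfolding has_vector_derivative_def has_derivative_within_alt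
          by auto
        have "g v - g u \<le> C * (v - u)"
          if "a \<le> u" "u \<le> x" "x \<le> v" "v \<le> b" "{u..v} \<subseteq> ball x d" for u v
        proof -
          have "u \<in> ball x d" "v \<in> ball x d"
            using that(2,3) by (intro subsetD[OF that(5)]; simp)+
          then have "\<bar>g u - g x - (u - x) * g'\<bar> \<le> e * \<bar>u - x\<bar>"
            "\<bar>g v - g x - (v - x) * g'\<bar> \<le> e * \<bar>v - x\<bar>"
            using that by (intro d; simp add: dist_real_def)+
          moreover have "\<bar>u - x\<bar> = x - u" "\<bar>v - x\<bar> = v - x"
            using that by auto
          \<comment> \<open>Because \<open>u \<le> x \<le> v\<close>, the errors at the two end
            points add up to exactly \<open>e * (v - u)\<close>.\<close>
          ultimately have "g v - g u \<le> (g' + e) * (v - u)"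
            by (simp add: algebra_simps)
          also have "\<dots> \<le> C * (v - u)"
            using that \<open>g' \<le> c\<close> by (intro mult_right_mono) (auto simp: C_def)
          finally show ?thesis .
        qed
        then show ?thesis
          using \<open>d > 0\<close> False by blast
      qed (use False in \<open>auto intro: exI[of _ 1]\<close>)
    qed
    then obtain d where d: "\<And>x. d x > 0" "\<And>x. x \<in> N \<Longrightarrow> ball x (d x) \<subseteq> U"
      and good: "\<And>x u v. x \<in> {a..b} - N \<Longrightarrow> a \<le> u \<Longrightarrow> u \<le> x \<Longrightarrow> x \<le> v \<Longrightarrow> v \<le> b \<Longrightarrow>
        {u..v} \<subseteq> ball x (d x) \<Longrightarrow> g v - g u \<le> C * (v - u)"
      by metis
    have "gauge (\<lambda>x. ball x (d x))"
      using d(1) by (auto simp: gauge_def)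
    then obtain p where p: "p tagged_division_of {a..b}" and fine: "(\<lambda>x. ball x (d x)) fine p"
      using fine_division_exists_real by blast
    have pD: "\<exists>u v. K = {u..v} \<and> u \<le> x \<and> x \<le> v \<and> a \<le> u \<and> v \<le> b \<and> {u..v} \<subseteq> ball x (d x)"
      if xK: "(x, K) \<in> p" for x K
    proof -
      obtain u v where "K = {u..v}"
        using tagged_division_ofD(4)[OF p xK] by (auto simp: cbox_interval)
      moreover have "x \<in> K" "K \<subseteq> {a..b}" "K \<subseteq> ball x (d x)"
        using tagged_division_ofD(2,3)[OF p xK] fineD[OF fine xK] by auto
      ultimately show ?thesis by auto
    qed
    \<comment> \<open>Degenerate intervals contribute nothing to the sums. Without them the open
      interiors are nonempty, so disjointness of interiors makes the passage from tagged intervals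
      to pairs of end points injective.\<close>
    define q where "q = {(x, K) \<in> p. x \<in> N \<and> Inf K < Sup K}"
    define P where "P = (\<lambda>(x, K). (Inf K, Sup K)) ` q"
    have finp: "finite p" using p by blast
    then have finq: "finite q" and "q \<subseteq> p"
      by (auto simp: q_def intro: rev_finite_subset)
    have disj: "{Inf K<..<Sup K} \<inter> {Inf K'<..<Sup K'} = {}"
      if "(x, K) \<in> q" "(x', K') \<in> q" "(x, K) \<noteq> (x', K')" for x K x' K'
    proof -
      have "(x, K) \<in> p" "(x', K') \<in> p"
        using that \<open>q \<subseteq> p\<close> by auto
      moreover from this have "interior K = {Inf K<..<Sup K}" "interior K' = {Inf K'<..<Sup K'}"
        by (auto dest!: pD)
      ultimately show ?thesis
        using tagged_division_ofD(5)[OF p] that(3) by metis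
    qed
    have inj: "inj_on (\<lambda>(x, K). (Inf K, Sup K)) q"
    proof (intro inj_onI, clarify)
      fix x K x' K' assume xK: "(x, K) \<in> q" "(x', K') \<in> q" "Inf K = Inf K'" "Sup K = Sup K'"
      have "{Inf K<..<Sup K} \<noteq> {}"
        using xK(1) by (auto simp: q_def)
      then show "x = x' \<and> K = K'"
        using disj[OF xK(1,2)] xK(3,4) by auto
    qed
    have P: "finite P" "\<forall>(u, v)\<in>P. u \<le> v \<and> {u..v} \<subseteq> {a..b} \<and> {u<..<v} \<subseteq> U"
      "disjoint_family_on (\<lambda>(u, v). {u<..<v}) P"
    proof -
      show "finite P" using finq by (simp add: P_def)
      have "Inf K \<le> Sup K \<and> {Inf K..Sup K} \<subseteq> {a..b} \<and> {Inf K<..<Sup K} \<subseteq> U"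
        if xK: "(x, K) \<in> q" for x K
      proof -
        have "ball x (d x) \<subseteq> U" using that d(2) by (auto simp: q_def)
        moreover obtain u v where "K = {u..v}" "u \<le> x" "x \<le> v" "a \<le> u" "v \<le> b"
            "{u..v} \<subseteq> ball x (d x)"
          using pD xK \<open>q \<subseteq> p\<close> by blast
        ultimately show ?thesis
          using greaterThanLessThan_subseteq_atLeastAtMost_iff[of u v u v] by auto
      qed
      then show "\<forall>(u, v)\<in>P. u \<le> v \<and> {u..v} \<subseteq> {a..b} \<and> {u<..<v} \<subseteq> U"
        unfolding P_def by fast
      show "disjoint_family_on (\<lambda>(u, v). {u<..<v}) P"
        unfolding disjoint_family_on_def
      proof (intro ballI impI)
        fix I J assume "I \<in> P" "J \<in> P" "I \<noteq> J"
        then obtain x K x' K' where "I = (Inf K, Sup K)" "J = (Inf K', Sup K')"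
            "(x, K) \<in> q" "(x', K') \<in> q" "(x, K) \<noteq> (x', K')"
          unfolding P_def by auto
        then show "(case I of (u, v) \<Rightarrow> {u<..<v}) \<inter> (case J of (u, v) \<Rightarrow> {u<..<v}) = {}"
          using disj by simp
      qed
    qed
    \<comment> \<open>The open intervals are disjoint and lie in \<open>U\<close>, so their total
      length is at most the measure of \<open>U\<close>.\<close>
    have len: "(\<Sum>(u, v)\<in>P. v - u) < \<eta>"
    proof -
      have eq: "(\<Sum>(u, v)\<in>P. v - u) = (\<Sum>I\<in>P. measure lebesgue (case I of (u, v) \<Rightarrow> {u<..<v}))"
        using P(2) by (intro sum.cong) auto
      also have "\<dots> = measure lebesgue (\<Union>I\<in>P. case I of (u, v) \<Rightarrow> {u<..<v})"
        using P by (intro measure_finite_Union[symmetric]) force+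
      also have "\<dots> \<le> measure lebesgue U"
        using P Um by (intro measure_mono_fmeasurable sets.finite_UN) auto
      also have "\<dots> < \<eta>" by fact
      finally show ?thesis .
    qed
    then have small: "(\<Sum>(u, v)\<in>P. norm (g v - g u)) < e"
      using \<eta> P by (intro \<delta>) auto
    \<comment> \<open>Subtracting the line of slope \<open>C\<close> makes every interval outside
      \<open>q\<close> contribute at most 0 to the telescoping sum, so only \<open>q\<close> has to
      be estimated.\<close>
    define F where "F t = g t - C * t" for t
    have "F b - F a = (\<Sum>(x, K)\<in>p. F (Sup K) - F (Inf K))"
      using additive_tagged_division_1[OF \<open>a \<le> b\<close> p, of F] by simp
    also have "\<dots> = (\<Sum>(x, K)\<in>q. F (Sup K) - F (Inf K)) + (\<Sum>(x, K)\<in>p - q. F (Sup K) - F (Inf K))"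
      by (subst sum.subset_diff[OF \<open>q \<subseteq> p\<close> finp]) (rule add.commute)
    also have "(\<Sum>(x, K)\<in>p - q. F (Sup K) - F (Inf K)) \<le> 0"
    proof (intro sum_nonpos, clarify)
      fix x K assume xK: "(x, K) \<in> p" "(x, K) \<notin> q"
      then obtain u v where uv: "K = {u..v}" "u \<le> x" "x \<le> v" "a \<le> u" "v \<le> b"
          "{u..v} \<subseteq> ball x (d x)"
        using pD by blast
      show "F (Sup K) - F (Inf K) \<le> 0"
      proof (cases "x \<in> N")
        case True
        then have "u = v"
          using xK uv by (auto simp: q_def)
        then show ?thesis
          using uv by simp
      next
        case False
        then have "g v - g u \<le> C * (v - u)"
          using uv by (intro good[of x]) auto
        then show ?thesis
          using uv by (simp add: F_def algebra_simps)
      qed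
    qed
    also have "(\<Sum>(x, K)\<in>q. F (Sup K) - F (Inf K)) = (\<Sum>(u, v)\<in>P. F v - F u)"
      unfolding P_def by (subst sum.reindex[OF inj]) (simp add: case_prod_unfold)
    also have "\<dots> \<le> (\<Sum>(u, v)\<in>P. norm (g v - g u) + \<bar>C\<bar> * (v - u))"
    proof (intro sum_mono, clarify)
      fix u v assume "(u, v) \<in> P"
      then have "u \<le> v" using P(2) by auto
      then have "(- C) * (v - u) \<le> \<bar>C\<bar> * (v - u)"
        by (intro mult_right_mono) auto
      then show "F v - F u \<le> norm (g v - g u) + \<bar>C\<bar> * (v - u)"
        by (simp add: F_def algebra_simps)
    qed
    also have "\<dots> = (\<Sum>(u, v)\<in>P. norm (g v - g u)) + \<bar>C\<bar> * (\<Sum>(u, v)\<in>P. v - u)"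
      by (simp add: case_prod_unfold sum.distrib sum_distrib_left)
    also have "\<dots> \<le> e + \<bar>C\<bar> * \<eta>"
      using small len by (intro add_mono mult_left_mono) auto
    finally have "F b - F a \<le> 2 * e"
      using \<eta>(3) by simp
    then show ?thesis
      by (simp add: F_def C_def algebra_simps)
  qed
  show ?thesis
  proof (rule field_le_epsilon)
    fix e' :: real assume "e' > 0"
    \<comment> \<open>Chosen so that the total error \<open>e * (b - a) + 2 * e\<close> equals
      \<open>e'\<close>.\<close>
    define e where "e = e' / (b - a + 2)"
    have "e > 0" using \<open>e' > 0\<close> \<open>a \<le> b\<close> by (simp add: e_def)
    from key[OF this] have "g b - g a \<le> c * (b - a) + e * (b - a + 2)"
      by (simp add: algebra_simps)
    also have "e * (b - a + 2) = e'"
      using \<open>a \<le> b\<close> by (simp add: e_def)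
    finally show "g b - g a \<le> c * (b - a) + e'" .
  qed
qed

lemma abs_continuous_on_subset:
  assumes "abs_continuous_on S \<phi>" "T \<subseteq> S"
  shows "abs_continuous_on T \<phi>"
  unfolding abs_continuous_on_def
proof (intro allI impI)
  fix e :: real assume "e > 0"
  obtain \<delta> where "\<delta> > 0" and \<delta>:
    "\<And>P. finite P \<Longrightarrow> (\<forall>(u, v)\<in>P. u \<le> v \<and> {u..v} \<subseteq> S) \<Longrightarrow>
      disjoint_family_on (\<lambda>(u, v). {u<..<v}) P \<Longrightarrow> (\<Sum>(u, v)\<in>P. v - u) < \<delta> \<Longrightarrow>
      (\<Sum>(u, v)\<in>P. norm (\<phi> v - \<phi> u)) < e"
    by (rule abs_continuous_onE[OF assms(1) \<open>e > 0\<close>]) (rule that)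
  have "\<forall>(u, v)\<in>P. u \<le> v \<and> {u..v} \<subseteq> S" if "\<forall>(u, v)\<in>P. u \<le> v \<and> {u..v} \<subseteq> T" for P
    using that assms(2) by (fastforce simp del: atLeastatMost_subset_iff)
  then show "\<exists>\<delta>>0. \<forall>P. finite P \<and> (\<forall>(u, v)\<in>P. u \<le> v \<and> {u..v} \<subseteq> T) \<and>
      disjoint_family_on (\<lambda>(u, v). {u<..<v}) P \<and> (\<Sum>(u, v)\<in>P. v - u) < \<delta> \<longrightarrow>
      (\<Sum>(u, v)\<in>P. norm (\<phi> v - \<phi> u)) < e"
    using \<open>\<delta> > 0\<close> \<delta> by (intro exI[of _ \<delta>] conjI allI impI) auto
qed

text \<open>Families consisting of a single interval already give uniform continuity.\<close>

lemma abs_continuous_on_imp_continuous_on: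
  fixes \<phi> :: "real \<Rightarrow> 'a::real_normed_vector"
  assumes "abs_continuous_on {a..b} \<phi>"
  shows "continuous_on {a..b} \<phi>"
  unfolding continuous_on_iff
proof (intro ballI allI impI)
  fix x e :: real assume "x \<in> {a..b}" "e > 0"
  obtain \<delta> where "\<delta> > 0" and \<delta>:
    "\<And>P. finite P \<Longrightarrow> (\<forall>(u, v)\<in>P. u \<le> v \<and> {u..v} \<subseteq> {a..b}) \<Longrightarrow>
      disjoint_family_on (\<lambda>(u, v). {u<..<v}) P \<Longrightarrow> (\<Sum>(u, v)\<in>P. v - u) < \<delta> \<Longrightarrow>
      (\<Sum>(u, v)\<in>P. norm (\<phi> v - \<phi> u)) < e"
    by (rule abs_continuous_onE[OF assms \<open>e > 0\<close>]) (rule that)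
  have less: "norm (\<phi> v - \<phi> u) < e" if "u \<in> {a..b}" "v \<in> {a..b}" "u \<le> v" "v - u < \<delta>" for u v
    using \<delta>[of "{(u, v)}"] that by (auto simp: disjoint_family_on_def)
  have "dist (\<phi> y) (\<phi> x) < e" if "y \<in> {a..b}" "dist y x < \<delta>" for y
    using less[of x y] less[of y x] that \<open>x \<in> {a..b}\<close>
    by (cases "x \<le> y") (auto simp: dist_norm norm_minus_commute)
  then show "\<exists>\<delta>>0. \<forall>y\<in>{a..b}. dist y x < \<delta> \<longrightarrow> dist (\<phi> y) (\<phi> x) < e"
    using \<open>\<delta> > 0\<close> by blast
qed

lemma abs_continuous_on_lipschitz_compose:
  assumes ac: "abs_continuous_on S \<phi>"
    and lip: "\<And>s t. s \<in> S \<Longrightarrow> t \<in> S \<Longrightarrow> norm (V (\<phi> s) - V (\<phi> t)) \<le> B * norm (\<phi> s - \<phi> t)"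
  shows "abs_continuous_on S (\<lambda>t. V (\<phi> t))"
  unfolding abs_continuous_on_def
proof (intro allI impI)
  fix e :: real assume "e > 0"
  \<comment> \<open>The constant \<open>B\<close> may be zero or negative;
    \<open>\<bar>B\<bar> + 1\<close> is a positive Lipschitz constant.\<close>
  define e' where "e' = e / (\<bar>B\<bar> + 1)"
  have "e' > 0" using \<open>e > 0\<close> by (simp add: e'_def)
  obtain \<delta> where "\<delta> > 0" and \<delta>:
    "\<And>P. finite P \<Longrightarrow> (\<forall>(u, v)\<in>P. u \<le> v \<and> {u..v} \<subseteq> S) \<Longrightarrow>
      disjoint_family_on (\<lambda>(u, v). {u<..<v}) P \<Longrightarrow> (\<Sum>(u, v)\<in>P. v - u) < \<delta> \<Longrightarrow>
      (\<Sum>(u, v)\<in>P. norm (\<phi> v - \<phi> u)) < e'"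
    by (rule abs_continuous_onE[OF ac \<open>e' > 0\<close>]) (rule that)
  have "(\<Sum>(u, v)\<in>P. norm (V (\<phi> v) - V (\<phi> u))) < e"
    if P: "finite P" "\<forall>(u, v)\<in>P. u \<le> v \<and> {u..v} \<subseteq> S"
      "disjoint_family_on (\<lambda>(u, v). {u<..<v}) P" "(\<Sum>(u, v)\<in>P. v - u) < \<delta>" for P
  proof -
    have "(\<Sum>(u, v)\<in>P. norm (V (\<phi> v) - V (\<phi> u))) \<le> (\<Sum>(u, v)\<in>P. (\<bar>B\<bar> + 1) * norm (\<phi> v - \<phi> u))"
    proof (intro sum_mono, clarify)
      fix u v assume "(u, v) \<in> P"
      then have "u \<le> v" "{u..v} \<subseteq> S" using P(2) by auto
      then have "u \<in> S" "v \<in> S" by auto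
      then have "norm (V (\<phi> v) - V (\<phi> u)) \<le> B * norm (\<phi> v - \<phi> u)"
        by (intro lip)
      also have "\<dots> \<le> (\<bar>B\<bar> + 1) * norm (\<phi> v - \<phi> u)"
        by (intro mult_right_mono) auto
      finally show "norm (V (\<phi> v) - V (\<phi> u)) \<le> (\<bar>B\<bar> + 1) * norm (\<phi> v - \<phi> u)" .
    qed
    also have "\<dots> = (\<bar>B\<bar> + 1) * (\<Sum>(u, v)\<in>P. norm (\<phi> v - \<phi> u))"
      by (simp add: case_prod_unfold sum_distrib_left)
    also have "\<dots> < (\<bar>B\<bar> + 1) * e'"
      using \<delta>[OF P] by (intro mult_strict_left_mono) auto
    also have "\<dots> = e"
      by (simp add: e'_def)
    finally show ?thesis .
  qed
  then show "\<exists>\<delta>>0. \<forall>P. finite P \<and> (\<forall>(u, v)\<in>P. u \<le> v \<and> {u..v} \<subseteq> S) \<and>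
      disjoint_family_on (\<lambda>(u, v). {u<..<v}) P \<and> (\<Sum>(u, v)\<in>P. v - u) < \<delta> \<longrightarrow>
      (\<Sum>(u, v)\<in>P. norm (V (\<phi> v) - V (\<phi> u))) < e"
    using \<open>\<delta> > 0\<close> by blast
qed

section \<open>Continuously differentiable functions along solutions\<close>

lemma continuously_differentiable_uminus:
  "continuously_differentiable V \<Longrightarrow> continuously_differentiable (\<lambda>x. - V x)"
  unfolding continuously_differentiable_def using GDERIV_minus continuous_on_minus by metis

lemma continuously_differentiable_GDERIV:
  "continuously_differentiable V \<Longrightarrow> GDERIV V x :> gradient V x"
  unfolding continuously_differentiable_def using gradient_eq by metis

lemma gradient_uminus:
  "continuously_differentiable V \<Longrightarrow> gradient (\<lambda>x. - V x) x = - gradient V x"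
  by (intro gradient_eq GDERIV_minus continuously_differentiable_GDERIV)

lemma continuously_differentiable_imp_continuous_on:
  fixes V :: "'a::real_inner \<Rightarrow> real"
  assumes "continuously_differentiable V"
  shows "continuous_on S V"
  using continuously_differentiable_GDERIV[OF assms] unfolding gderiv_def
  by (meson continuous_at_imp_continuous_on has_derivative_continuous)

text \<open>The set need not be convex or closed, so it is enclosed in a closed ball: compactness
  bounds the gradient there, and convexity allows the mean value inequality.\<close>

lemma continuously_differentiable_lipschitz_on_bounded:
  fixes V :: "'a::euclidean_space \<Rightarrow> real"
  assumes "continuously_differentiable V" "bounded S"
  obtains B where "\<And>x y. x \<in> S \<Longrightarrow> y \<in> S \<Longrightarrow> norm (V x - V y) \<le> B * norm (x - y)"
proof -
  obtain G where G: "\<And>x. GDERIV V x :> G x" "continuous_on UNIV G"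
    using assms(1) unfolding continuously_differentiable_def by blast
  obtain R where R: "S \<subseteq> cball 0 R"
    using assms(2) bounded_subset_ballD ball_subset_cball by (metis order_trans)
  have "compact (G ` cball 0 R)"
    using G(2) by (intro compact_continuous_image) (auto intro: continuous_on_subset)
  then have "bounded (G ` cball 0 R)"
    by (rule compact_imp_bounded)
  then obtain B where B: "\<And>x. x \<in> cball 0 R \<Longrightarrow> norm (G x) \<le> B"
    unfolding bounded_iff by blast
  have "norm (V x - V y) \<le> B * norm (x - y)" if "x \<in> S" "y \<in> S" for x y
  proof (rule differentiable_bound[where S = "cball 0 R"])
    fix z assume z: "z \<in> cball (0::'a) R"
    show "(V has_derivative (\<lambda>u. u \<bullet> G z)) (at z within cball 0 R)"
      using G(1)[of z] unfolding gderiv_def by (rule has_derivative_at_withinI)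
    show "onorm (\<lambda>u. u \<bullet> G z) \<le> B"
    proof (rule onorm_le)
      fix u :: 'a
      have "norm (u \<bullet> G z) \<le> norm (G z) * norm u"
        using Cauchy_Schwarz_ineq2[of u "G z"] by (simp add: mult.commute)
      also have "\<dots> \<le> B * norm u"
        using B[OF z] by (intro mult_right_mono) auto
      finally show "norm (u \<bullet> G z) \<le> B * norm u" .
    qed
  qed (use that R in auto)
  then show thesis using that by blast
qed

lemma solution_continuous_on:
  assumes "solution f x0 d \<phi>"
  shows "continuous_on {0..T} \<phi>"
proof (cases "T > 0")
  case True
  then show ?thesis
    using assms abs_continuous_on_imp_continuous_on unfolding solution_def by blast
next
  case False
  then have "{0..T} = {} \<or> {0..T} = {0}" by auto
  then show ?thesis by auto
qed

text \<open>The trajectory stays in a bounded set on \<open>{s..t}\<close>, where \<open>V\<close>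
  is Lipschitz; hence \<open>V\<close> along the trajectory is absolutely continuous, and the chain
  rule bounds its derivative at almost every time. Asking for the bound at interior times only suits
  arguments that stop at the first time a level is reached.\<close>

lemma solution_growth_le:
  fixes f :: "real^'n \<Rightarrow> real^'m \<Rightarrow> real^'n"
  assumes sol: "solution f x0 d \<phi>" and V: "continuously_differentiable V"
    and st: "0 \<le> s" "s \<le> t"
    and le: "\<And>\<tau>. s < \<tau> \<Longrightarrow> \<tau> < t \<Longrightarrow> gradient V (\<phi> \<tau>) \<bullet> f (\<phi> \<tau>) (d \<tau>) \<le> c"
  shows "V (\<phi> t) - V (\<phi> s) \<le> c * (t - s)"
proof (cases "s = t")
  case False
  then have "t > 0" using st by simp
  have ac: "abs_continuous_on {s..t} \<phi>"
    using sol \<open>t > 0\<close> st unfolding solution_def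
    by (auto intro: abs_continuous_on_subset[of "{0..t}"])
  have "bounded (\<phi> ` {s..t})"
    using abs_continuous_on_imp_continuous_on[OF ac]
    by (intro compact_imp_bounded compact_continuous_image) auto
  then obtain B where B: "\<And>x y. x \<in> \<phi> ` {s..t} \<Longrightarrow> y \<in> \<phi> ` {s..t} \<Longrightarrow>
      norm (V x - V y) \<le> B * norm (x - y)"
    using continuously_differentiable_lipschitz_on_bounded[OF V] by metis
  have acV: "abs_continuous_on {s..t} (\<lambda>\<tau>. V (\<phi> \<tau>))"
    using ac by (rule abs_continuous_on_lipschitz_compose[where B = B]) (rule B; rule imageI; assumption)
  define N where
    "N = {\<tau>\<in>{0..}. \<not> (\<phi> has_vector_derivative f (\<phi> \<tau>) (d \<tau>)) (at \<tau> within {0..})}"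
  have "AE \<tau> in lebesgue. \<tau> \<in> {0..} \<longrightarrow>
      (\<phi> has_vector_derivative f (\<phi> \<tau>) (d \<tau>)) (at \<tau> within {0..})"
    using sol unfolding solution_def by (subst (asm) AE_restrict_space_iff) auto
  then have "negligible N"
    by (simp add: N_def negligible_iff_null_sets completion.AE_iff_null_sets Collect_conj_eq)
  \<comment> \<open>The end points join the exceptional set because the bound \<open>c\<close> is
    known strictly between them only.\<close>
  then have "negligible (N \<union> {s, t})" by simp
  then show ?thesis
  proof (rule abs_continuous_on_deriv_le[OF acV st(2)])
    fix \<tau> assume \<tau>: "\<tau> \<in> {s..t} - (N \<union> {s, t})"
    then have "(\<phi> has_vector_derivative f (\<phi> \<tau>) (d \<tau>)) (at \<tau> within {s..t})"
      using st by (auto simp: N_def intro: has_vector_derivative_within_subset)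
    moreover have "(V has_derivative (\<lambda>u. u \<bullet> gradient V (\<phi> \<tau>))) (at (\<phi> \<tau>))"
      using continuously_differentiable_GDERIV[OF V] unfolding gderiv_def .
    ultimately have "((\<lambda>\<tau>. V (\<phi> \<tau>)) has_vector_derivative gradient V (\<phi> \<tau>) \<bullet> f (\<phi> \<tau>) (d \<tau>))
        (at \<tau> within {s..t})"
      unfolding has_vector_derivative_def
      by (auto dest: has_derivative_compose simp: inner_commute)
    moreover have "gradient V (\<phi> \<tau>) \<bullet> f (\<phi> \<tau>) (d \<tau>) \<le> c"
      using \<tau> by (intro le) auto
    ultimately show "\<exists>g'\<le>c. ((\<lambda>\<tau>. V (\<phi> \<tau>)) has_vector_derivative g') (at \<tau> within {s..t})"
      by blast
  qed
qed simp

text \<open>The upper estimate for \<open>- V\<close>; it serves case (ii), where the derivative of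
  \<open>W\<close> is bounded from below.\<close>

lemma solution_growth_ge:
  fixes f :: "real^'n \<Rightarrow> real^'m \<Rightarrow> real^'n"
  assumes "solution f x0 d \<phi>" and V: "continuously_differentiable V"
    and "0 \<le> s" "s \<le> t"
    and "\<And>\<tau>. s < \<tau> \<Longrightarrow> \<tau> < t \<Longrightarrow> c \<le> gradient V (\<phi> \<tau>) \<bullet> f (\<phi> \<tau>) (d \<tau>)"
  shows "c * (t - s) \<le> V (\<phi> t) - V (\<phi> s)"
  using solution_growth_le[OF assms(1) continuously_differentiable_uminus[OF V] assms(3,4), of "- c"]
    assms(5) gradient_uminus[OF V] by simp

section \<open>Output attractivity\<close>

text \<open>Once \<open>v\<close> is within \<open>c\<close> of its infimum, it can no longer drop
  by \<open>c\<close>, so \<open>w\<close> stays below \<open>\<epsilon>\<close> from then on. The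
  condition \<open>s \<ge> t - \<tau>\<close> admits a window that ends at \<open>t\<close> as well
  as one that starts there.\<close>

lemma dissipation_tendsto_0:
  fixes v w :: "real \<Rightarrow> real"
  assumes "\<And>t. 0 \<le> t \<Longrightarrow> 0 \<le> v t" and anti: "\<And>s t. 0 \<le> s \<Longrightarrow> s \<le> t \<Longrightarrow> v t \<le> v s"
    and "\<And>t. 0 \<le> w t" and "r > 0"
    and drop: "\<And>\<epsilon>. 0 < \<epsilon> \<Longrightarrow> \<epsilon> < r \<Longrightarrow>
      \<exists>\<tau>>0. \<exists>c>0. \<forall>t\<ge>\<tau>. \<epsilon> \<le> w t \<longrightarrow> (\<exists>s\<ge>t - \<tau>. v (s + \<tau>) \<le> v s - c)"
  shows "(w \<longlongrightarrow> 0) at_top"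
proof (rule tendstoI)
  fix e :: real assume "e > 0"
  \<comment> \<open>The drop condition is available for levels below \<open>r\<close> only.\<close>
  define \<epsilon> where "\<epsilon> = min e (r / 2)"
  have \<epsilon>: "0 < \<epsilon>" "\<epsilon> < r" "\<epsilon> \<le> e"
    using \<open>e > 0\<close> \<open>r > 0\<close> by (auto simp: \<epsilon>_def)
  obtain \<tau> c where "\<tau> > 0" "c > 0"
    and \<tau>: "\<And>t. \<tau> \<le> t \<Longrightarrow> \<epsilon> \<le> w t \<Longrightarrow> \<exists>s\<ge>t - \<tau>. v (s + \<tau>) \<le> v s - c"
    using drop[OF \<epsilon>(1,2)] by blast
  define L where "L = Inf (v ` {0..})"
  have bdd: "bdd_below (v ` {0..})"
    using assms(1) by (auto intro: bdd_belowI[of _ 0])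
  have L: "L \<le> v t" if "0 \<le> t" for t
    unfolding L_def using that bdd by (intro cINF_lower) auto
  obtain T where "T \<ge> 0" "v T < L + c"
    using cINF_less_iff[OF _ bdd, of "L + c"] \<open>c > 0\<close> by (auto simp: L_def)
  have "w t < e" if t: "t \<ge> T + \<tau>" for t
  proof (rule ccontr)
    assume "\<not> w t < e"
    then obtain s where "s \<ge> t - \<tau>" "v (s + \<tau>) \<le> v s - c"
      using \<tau>[of t] \<epsilon> t \<open>T \<ge> 0\<close> by auto
    moreover from this have "v s \<le> v T"
      using t \<open>T \<ge> 0\<close> by (intro anti) auto
    moreover have "L \<le> v (s + \<tau>)"
      using t \<open>s \<ge> t - \<tau>\<close> \<open>T \<ge> 0\<close> \<open>\<tau> > 0\<close> by (intro L) auto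
    ultimately show False
      using \<open>v T < L + c\<close> by simp
  qed
  then have "dist (w t) 0 < e" if "t \<ge> T + \<tau>" for t
    using that assms(3) by simp
  then show "\<forall>\<^sub>F t in at_top. dist (w t) 0 < e"
    using eventually_at_top_linorder by blast
qed

text \<open>By compactness \<open>\<rho>\<close> attains a positive minimum on
  \<open>{\<delta>..R}\<close>; if this interval is empty, any constant will do.\<close>

lemma positive_definite_lower_bound:
  assumes "continuous_on {0..} \<rho>" "positive_definite \<rho>" "\<delta> > 0"
  obtains m where "m > 0" "\<And>y. \<delta> \<le> y \<Longrightarrow> y \<le> R \<Longrightarrow> m \<le> \<rho> y"
proof (cases "\<delta> \<le> R")
  case True
  then obtain z where z: "z \<in> {\<delta>..R}" "\<And>y. y \<in> {\<delta>..R} \<Longrightarrow> \<rho> z \<le> \<rho> y"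
    using continuous_attains_inf[of "{\<delta>..R}" \<rho>] assms(1,3)
    by (force intro: continuous_on_subset)
  then have "\<rho> z > 0"
    using assms(2,3) by (auto simp: positive_definite_def)
  with z show thesis by (intro that[of "\<rho> z"]) auto
qed (use that[of 1] in auto)

text \<open>The limit inferior bounds \<open>\<rho>\<close> from below beyond some \<open>R\<close>,
  and compactness does so between \<open>\<delta>\<close> and \<open>R\<close>.\<close>

lemma positive_definite_lower_bound_at_top:
  assumes "continuous_on {0..} \<rho>" "positive_definite \<rho>" "\<delta> > 0"
    and "Liminf at_top (\<lambda>s. ereal (\<rho> s)) > 0"
  obtains m where "m > 0" "\<And>y. \<delta> \<le> y \<Longrightarrow> m \<le> \<rho> y"
proof -
  obtain c where c: "0 < c" "ereal c < Liminf at_top (\<lambda>s. ereal (\<rho> s))"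
    using ereal_dense2[OF assms(4)] by auto
  obtain R where R: "\<And>y. y \<ge> R \<Longrightarrow> c < \<rho> y"
    using less_LiminfD[OF c(2)] by (auto simp: eventually_at_top_linorder)
  obtain m where m: "m > 0" "\<And>y. \<delta> \<le> y \<Longrightarrow> y \<le> R \<Longrightarrow> m \<le> \<rho> y"
    using positive_definite_lower_bound[OF assms(1-3)] by blast
  show thesis
  proof (rule that)
    show "min c m > 0" using c m by simp
    show "min c m \<le> \<rho> y" if "\<delta> \<le> y" for y
      using R[of y] m(2)[of y] that by linarith
  qed
qed

text \<open>By monotonicity \<open>a (u t) < a e\<close> forces \<open>u t < e\<close>, so no
  inverse of \<open>a\<close> has to be constructed.\<close>

lemma class_K_tendsto_0D:
  assumes "class_K a" and "\<And>t. 0 \<le> u t" and "((\<lambda>t. a (u t)) \<longlongrightarrow> 0) F"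
  shows "(u \<longlongrightarrow> 0) F"
proof (rule tendstoI)
  have mono: "strict_mono_on {0..} a" "a 0 = 0"
    using assms(1) by (auto simp: class_K_def)
  fix e :: real assume "e > 0"
  then have "a e > 0"
    using strict_mono_onD[OF mono(1), of 0 e] mono(2) by simp
  from order_tendstoD(2)[OF assms(3) this] show "\<forall>\<^sub>F t in F. dist (u t) 0 < e"
  proof eventually_elim
    case (elim t)
    then have "u t < e"
      using strict_mono_on_leD[OF mono(1), of e "u t"] \<open>e > 0\<close> assms(2)[of t] by force
    then show ?case using assms(2)[of t] by simp
  qed
qed

theorem theorem2:
  fixes D :: "(real^'m) set"
    and f :: "real^'n \<Rightarrow> real^'m \<Rightarrow> real^'n"
    and h :: "real^'n \<Rightarrow> real^'k"
    and V W Q :: "real^'n \<Rightarrow> real"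
    and a \<rho> \<gamma> :: "real \<Rightarrow> real"
    and r :: real
  assumes "standing_assumptions D f h"
    and "forward_complete D f"
    and "r > 0"
    and "continuously_differentiable V" and "\<forall>x. V x \<ge> 0"
    and "continuously_differentiable W" and "\<forall>x. W x \<ge> 0"
    and "continuously_differentiable Q" and "\<forall>x. Q x \<ge> 0"
    and "class_K a"
    and "continuous_on {0..} \<rho>" and "positive_definite \<rho>"
    and "\<forall>x. \<forall>d\<in>D. gradient V x \<bullet> f x d \<le> - \<rho> (W x)"
    and "\<forall>x. \<forall>d\<in>D. gradient Q x \<bullet> f x d \<le> 0"
    and "\<forall>x. W x < r \<longrightarrow> a (norm (h x)) \<le> W x"
    and "continuous_on {0..} \<gamma>" and "\<forall>s\<ge>0. \<gamma> s \<ge> 0"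
    and "(\<forall>d\<in>D. \<forall>x. W x < r \<longrightarrow> gradient W x \<bullet> f x d \<le> \<gamma> (Q x)) \<or>
         (\<forall>x. \<forall>d\<in>D. gradient W x \<bullet> f x d \<ge> - \<gamma> (Q x))"
    and "Liminf at_top (\<lambda>s. ereal (\<rho> s)) > 0 \<or>
         (\<exists>\<zeta>. class_Kinf \<zeta> \<and> (\<forall>x. W x \<le> \<zeta> (Q x)))"
  shows "RGOA D f h"
  unfolding RGOA_def
proof (intro allI ballI impI)
  fix x0 d \<phi> assume "d \<in> inputs D" and sol: "solution f x0 d \<phi>"
  then have dD: "d t \<in> D" if "0 \<le> t" for t
    using that by (auto simp: inputs_def)
  have \<rho>_nonneg: "\<rho> (W x) \<ge> 0" for x
    using assms(7,12) unfolding positive_definite_def by (metis order_le_less)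
  have V_anti: "V (\<phi> t) \<le> V (\<phi> s)" if "0 \<le> s" "s \<le> t" for s t
    using solution_growth_le[OF sol assms(4) that, of 0] assms(13) dD that \<rho>_nonneg
    by (smt (verit) mult_zero_left)
  have Q_le: "Q (\<phi> t) \<le> Q x0" if "0 \<le> t" for t
  proof -
    have "Q (\<phi> t) - Q (\<phi> 0) \<le> 0 * (t - 0)"
      using assms(14) dD that by (intro solution_growth_le[OF sol assms(8)]) auto
    then show ?thesis
      using sol by (simp add: solution_def)
  qed
  \<comment> \<open>Since \<open>Q\<close> stays in \<open>{0..Q x0}\<close> along the solution,
    compactness turns \<open>\<gamma>\<close> into a constant bound \<open>M\<close>, taken positive
    in order to divide by it.\<close>
  have "compact (\<gamma> ` {0..Q x0})"
    using assms(16) by (intro compact_continuous_image) (auto intro: continuous_on_subset)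
  then obtain M where "M > 0" and "\<forall>y\<in>\<gamma> ` {0..Q x0}. norm y \<le> M"
    using compact_imp_bounded bounded_pos by metis
  then have \<gamma>_le: "\<gamma> (Q (\<phi> t)) \<le> M" if "0 \<le> t" for t
    using Q_le[OF that] assms(9) by (fastforce dest: bspec[of _ _ "Q (\<phi> t)"])
  have contW: "continuous_on {0..T} (\<lambda>t. W (\<phi> t))" for T
    using continuously_differentiable_imp_continuous_on[OF assms(6)] solution_continuous_on[OF sol]
    by (rule continuous_on_compose2) (rule subset_UNIV)
  have W_lim: "((\<lambda>t. W (\<phi> t)) \<longlongrightarrow> 0) at_top"
  proof (rule dissipation_tendsto_0[where v = "\<lambda>t. V (\<phi> t)"])
    fix \<epsilon> :: real assume \<epsilon>: "0 < \<epsilon>" "\<epsilon> < r"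
    \<comment> \<open>At a rate of at most \<open>M\<close>, a change of \<open>W\<close> by more
      than \<open>\<epsilon> / 2\<close> takes longer than \<open>\<tau>\<close>.\<close>
    define \<tau> where "\<tau> = \<epsilon> / (2 * M)"
    have \<tau>: "\<tau> > 0" "M * \<tau> = \<epsilon> / 2"
      using \<epsilon> \<open>M > 0\<close> by (auto simp: \<tau>_def)
    \<comment> \<open>Large values of \<open>W\<close> are the difficulty: either the limit inferior
      of \<open>\<rho>\<close> controls them, or \<open>\<zeta> (Q x0)\<close> bounds
      \<open>W\<close> along the solution.\<close>
    obtain c where "c > 0" and c: "\<And>t. 0 \<le> t \<Longrightarrow> \<epsilon> / 2 \<le> W (\<phi> t) \<Longrightarrow> c \<le> \<rho> (W (\<phi> t))"
      using assms(19)
    proof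
      assume "Liminf at_top (\<lambda>s. ereal (\<rho> s)) > 0"
      then show thesis
        using positive_definite_lower_bound_at_top[OF assms(11,12), of "\<epsilon> / 2"] \<epsilon>(1) that
        by (metis half_gt_zero)
    next
      assume "\<exists>\<zeta>. class_Kinf \<zeta> \<and> (\<forall>x. W x \<le> \<zeta> (Q x))"
      then obtain \<zeta> where \<zeta>: "strict_mono_on {0..} \<zeta>" "\<And>x. W x \<le> \<zeta> (Q x)"
        by (auto simp: class_Kinf_def class_K_def)
      have "W (\<phi> t) \<le> \<zeta> (Q x0)" if "0 \<le> t" for t
        using \<zeta>(2)[of "\<phi> t"] strict_mono_on_leD[OF \<zeta>(1) _ _ Q_le[OF that]] assms(9)
        by (meson atLeast_iff order_trans)
      then show thesis
        using positive_definite_lower_bound[OF assms(11,12), of "\<epsilon> / 2" "\<zeta> (Q x0)"] \<epsilon>(1) that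
        by (metis half_gt_zero)
    qed
    have stay: "\<exists>s\<ge>t - \<tau>. \<forall>\<sigma>\<in>{s..s + \<tau>}. \<epsilon> / 2 \<le> W (\<phi> \<sigma>)"
      if t: "\<tau> \<le> t" "\<epsilon> \<le> W (\<phi> t)" for t
      using assms(18)
    proof
      assume W: "\<forall>d\<in>D. \<forall>x. W x < r \<longrightarrow> gradient W x \<bullet> f x d \<le> \<gamma> (Q x)"
      have "\<epsilon> / 2 \<le> W (\<phi> \<sigma>)" if \<sigma>: "\<sigma> \<in> {t - \<tau>..t}" for \<sigma>
      proof -
        have "continuous_on {\<sigma>..t} (\<lambda>t. W (\<phi> t))"
          by (rule continuous_on_subset[OF contW[of t]]) (use t \<sigma> in auto)
        then have "closed ({\<sigma>..t} \<inter> (\<lambda>t. W (\<phi> t)) -` {\<epsilon>..})"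
          by (rule continuous_closed_preimage) auto
        then have "compact ({\<sigma>..t} \<inter> (\<lambda>t. W (\<phi> t)) -` {\<epsilon>..})"
          by (simp add: compact_eq_bounded_closed bounded_Int)
        moreover have "t \<in> {\<sigma>..t} \<inter> (\<lambda>t. W (\<phi> t)) -` {\<epsilon>..}"
          using \<sigma> t by auto
        \<comment> \<open>The rate bound of case (i) holds only where \<open>W < r\<close>. At the
          first time \<open>s\<close> in \<open>{\<sigma>..t}\<close> with
          \<open>W \<ge> \<epsilon>\<close>, all times between \<open>\<sigma>\<close> and
          \<open>s\<close> satisfy \<open>W < \<epsilon> < r\<close>, so the bound applies on the
          whole stretch.\<close>
        ultimately obtain s where s: "\<sigma> \<le> s" "s \<le> t" "\<epsilon> \<le> W (\<phi> s)"
          and first: "\<And>u. u \<in> {\<sigma>..t} \<inter> (\<lambda>t. W (\<phi> t)) -` {\<epsilon>..} \<Longrightarrow> s \<le> u"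
          by (metis compact_attains_inf empty_iff IntE atLeastAtMost_iff atLeast_iff vimageE)
        have "W (\<phi> s) - W (\<phi> \<sigma>) \<le> M * (s - \<sigma>)"
        proof (rule solution_growth_le[OF sol assms(6)])
          fix u assume u: "\<sigma> < u" "u < s"
          then have "W (\<phi> u) < \<epsilon>"
            using first[of u] s by force
          moreover have "0 \<le> u" using u \<sigma> t by auto
          ultimately show "gradient W (\<phi> u) \<bullet> f (\<phi> u) (d u) \<le> M"
            using W dD \<gamma>_le \<epsilon>(2) by (meson less_trans order_trans)
        qed (use s \<sigma> t in auto)
        also have "M * (s - \<sigma>) \<le> M * \<tau>"
          using \<sigma> s \<open>M > 0\<close> by (intro mult_left_mono) auto
        finally show ?thesis
          using s \<tau> by simp
      qed
      then show ?thesis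
        by (intro exI[of _ "t - \<tau>"]) auto
    next
      assume W: "\<forall>x. \<forall>d\<in>D. gradient W x \<bullet> f x d \<ge> - \<gamma> (Q x)"
      \<comment> \<open>In case (ii) the rate bound is global, so no first time is needed: going
        forward from \<open>t\<close>, \<open>W\<close> loses at most
        \<open>M * \<tau>\<close>.\<close>
      have "\<epsilon> / 2 \<le> W (\<phi> \<sigma>)" if \<sigma>: "\<sigma> \<in> {t..t + \<tau>}" for \<sigma>
      proof -
        have "(- M) * (\<sigma> - t) \<le> W (\<phi> \<sigma>) - W (\<phi> t)"
        proof (rule solution_growth_ge[OF sol assms(6)])
          fix u assume "t < u"
          then have "0 \<le> u" using t \<tau>(1) by simp
          then show "- M \<le> gradient W (\<phi> u) \<bullet> f (\<phi> u) (d u)"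
            using W dD \<gamma>_le by (meson neg_le_iff_le order_trans)
        qed (use \<sigma> t \<tau> in auto)
        moreover have "M * (\<sigma> - t) \<le> M * \<tau>"
          using \<sigma> \<open>M > 0\<close> by (intro mult_left_mono) auto
        ultimately show ?thesis
          using t \<tau> by simp
      qed
      then show ?thesis
        using \<tau>(1) by (intro exI[of _ t]) auto
    qed
    have "\<exists>s\<ge>t - \<tau>. V (\<phi> (s + \<tau>)) \<le> V (\<phi> s) - c * \<tau>" if t: "\<tau> \<le> t" "\<epsilon> \<le> W (\<phi> t)" for t
    proof -
      obtain s where s: "s \<ge> t - \<tau>" "\<And>\<sigma>. \<sigma> \<in> {s..s + \<tau>} \<Longrightarrow> \<epsilon> / 2 \<le> W (\<phi> \<sigma>)"
        using stay[OF t] by blast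
      have "V (\<phi> (s + \<tau>)) - V (\<phi> s) \<le> (- c) * (s + \<tau> - s)"
      proof (rule solution_growth_le[OF sol assms(4)])
        fix u assume u: "s < u" "u < s + \<tau>"
        then have "0 \<le> u" using s(1) t(1) by simp
        moreover from this have "c \<le> \<rho> (W (\<phi> u))"
          using u by (intro c s(2)) auto
        ultimately show "gradient V (\<phi> u) \<bullet> f (\<phi> u) (d u) \<le> - c"
          using assms(13) dD by (meson neg_le_iff_le order_trans)
      qed (use s t \<tau> in auto)
      with s(1) show ?thesis
        by (intro exI[of _ s]) simp
    qed
    then show "\<exists>\<tau>>0. \<exists>c>0. \<forall>t\<ge>\<tau>. \<epsilon> \<le> W (\<phi> t) \<longrightarrow>
        (\<exists>s\<ge>t - \<tau>. V (\<phi> (s + \<tau>)) \<le> V (\<phi> s) - c)"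
      using \<tau>(1) \<open>c > 0\<close> by (intro exI[of _ \<tau>] conjI exI[of _ "c * \<tau>"]) auto
  qed (use assms(3,5,7) V_anti in auto)
  \<comment> \<open>The output is controlled by \<open>W\<close> only below level \<open>r\<close>,
    which the solution eventually respects.\<close>
  have "\<forall>\<^sub>F t in at_top. W (\<phi> t) < r"
    using W_lim \<open>r > 0\<close> by (rule order_tendstoD)
  then have a_le: "\<forall>\<^sub>F t in at_top. a (norm (h (\<phi> t))) \<le> W (\<phi> t)"
    by eventually_elim (use assms(15) in blast)
  have "((\<lambda>t. a (norm (h (\<phi> t)))) \<longlongrightarrow> 0) at_top"
    by (rule tendsto_sandwich[OF _ a_le tendsto_const W_lim])
      (simp add: class_K_nonneg[OF assms(10)])
  then have "((\<lambda>t. norm (h (\<phi> t))) \<longlongrightarrow> 0) at_top"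
    by (rule class_K_tendsto_0D[OF assms(10), rotated]) auto
  then show "((\<lambda>t. h (\<phi> t)) \<longlongrightarrow> 0) at_top"
    by (rule tendsto_norm_zero_cancel)
qed

end
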